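(* Let $X$ be an F-$\mathbb{BC}$ module with hyperbolic norm $\|\cdot\|_{\mathbb{D}}$, and let $P_0$ be a set of continuous hyperbolic semi-norms on $X$ such that for each $x\in X$ the set $\{p_{\mathbb{D}}(x):p_{\mathbb{D}}\in P_0\}$ is $\mathbb{D}$-bounded. Then there exists $\delta\in\mathbb{D}^+$ such that $p_{\mathbb{D}}(x)\le\delta\|x\|_{\mathbb{D}}$ for all $x\in X$ and all $p_{\mathbb{D}}\in P_0$.
   Context: Bicomplex and hyperbolic numbers. $\mathbb{BC}=\{z_1+z_2 j : z_1,z_2\in\mathbb{C}(i)\}$ with $i^2=j^2=-1$, $ij=ji=k$ (so $k^2=1$); it is a commutative ring. $\mathbb{D}=\{\beta_1+k\beta_2:\beta_1,\beta_2\in\mathbb{R}\}\subset\mathbb{BC}$ is the ring of hyperbolic numbers. With $e_1=\frac{1+k}{2}$, $e_2=\frac{1-k}{2}$ one has $e_1^2=e_1$, $e_2^2=e_2$, $e_1+e_2=1$, $e_1e_2=0$, and each $Z\in\mathbb{BC}$ is uniquely $Z=e_1z_1+e_2z_2$ with $z_1,z_2\in\mathbb{C}(i)$; $Z\in\mathbb{D}$ iff $z_1,z_2$ are real. Put $|Z|_k=e_1|z_1|+e_2|z_2|$. Let $\mathbb{D}^+=\{e_1\alpha_1+e_2\alpha_2:\alpha_1,\alpha_2\ge 0\}$. The partial order on $\mathbb{D}$ is $\alpha\le\beta$ iff $\beta-\alpha\in\mathbb{D}^+$. Convergence in $\mathbb{D}$ is componentwise with respect to $e_1,e_2$. A set $A\subset\mathbb{D}^+$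 is $\mathbb{D}$-bounded if there is $M\in\mathbb{D}^+$ with $\alpha\le M$ for all $\alpha\in A$. Norms and semi-norms. A hyperbolic semi-norm on a $\mathbb{BC}$-module $X$ is a map $p_{\mathbb{D}}:X\to\mathbb{D}^+$ with $p_{\mathbb{D}}(\mu x)=|\mu|_k\,p_{\mathbb{D}}(x)$ and $p_{\mathbb{D}}(x+y)\le p_{\mathbb{D}}(x)+p_{\mathbb{D}}(y)$ for all $x,y\in X$, $\mu\in\mathbb{BC}$. A hyperbolic norm $\|\cdot\|_{\mathbb{D}}$ is a hyperbolic semi-norm that vanishes only at $x=0$. $x_n\to x$ means $\|x_n-x\|_{\mathbb{D}}\to 0$ in $\mathbb{D}$. An F-$\mathbb{BC}$ module is a $\mathbb{BC}$-module with a hyperbolic norm for which every Cauchy sequence converges. Continuity of $p_{\mathbb{D}}$ means: $x_n\to x$ in $X$ implies $p_{\mathbb{D}}(x_n)\to p_{\mathbb{D}}(x)$ in $\mathbb{D}$. *)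

theory Defs
  imports "HOL-Analysis.Analysis"
begin

section \<open>Bicomplex numbers\<close>

text \<open>\<open>Bicomplex z1 z2\<close> stands for $z_1 + z_2 j$, where the imaginary unit of type
  \<^typ>\<open>complex\<close> plays the role of $i$.\<close>

codatatype bicomplex = Bicomplex (bc_fst: complex) (bc_snd: complex)

lemma bicomplex_eqI: "bc_fst Z = bc_fst W \<Longrightarrow> bc_snd Z = bc_snd W \<Longrightarrow> Z = W"
  by (rule bicomplex.expand) simp

lemma bicomplex_eq_iff: "Z = W \<longleftrightarrow> bc_fst Z = bc_fst W \<and> bc_snd Z = bc_snd W"
  by (auto intro: bicomplex_eqI)

instantiation bicomplex :: comm_ring_1
begin

primcorec zero_bicomplex where
  "bc_fst 0 = 0"
| "bc_snd 0 = 0"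

primcorec one_bicomplex where
  "bc_fst 1 = 1"
| "bc_snd 1 = 0"

primcorec plus_bicomplex where
  "bc_fst (Z + W) = bc_fst Z + bc_fst W"
| "bc_snd (Z + W) = bc_snd Z + bc_snd W"

primcorec uminus_bicomplex where
  "bc_fst (- Z) = - bc_fst Z"
| "bc_snd (- Z) = - bc_snd Z"

primcorec minus_bicomplex where
  "bc_fst (Z - W) = bc_fst Z - bc_fst W"
| "bc_snd (Z - W) = bc_snd Z - bc_snd W"

primcorec times_bicomplex where
  "bc_fst (Z * W) = bc_fst Z * bc_fst W - bc_snd Z * bc_snd W"
| "bc_snd (Z * W) = bc_fst Z * bc_snd W + bc_snd Z * bc_fst W"

instance
  by standard (simp_all add: bicomplex_eq_iff algebra_simps)

end

definition bc_of_complex :: "complex \<Rightarrow> bicomplex" where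
  "bc_of_complex z = Bicomplex z 0"

definition bc_of_real :: "real \<Rightarrow> bicomplex" where
  "bc_of_real r = bc_of_complex (of_real r)"

definition bc_j :: bicomplex where
  "bc_j = Bicomplex 0 1"

definition bc_k :: bicomplex where
  "bc_k = bc_of_complex \<i> * bc_j"

definition bc_e1 :: bicomplex where
  "bc_e1 = bc_of_real (1/2) * (1 + bc_k)"

definition bc_e2 :: bicomplex where
  "bc_e2 = bc_of_real (1/2) * (1 - bc_k)"

text \<open>Since $j = -ik$ and $k = e_1 - e_2$, the coordinates of $z_1 + z_2 j$ with respect to
  $e_1, e_2$ are $z_1 - i z_2$ and $z_1 + i z_2$; see \<open>idempotent_decomposition\<close> below.\<close>

definition bc_comp1 :: "bicomplex \<Rightarrow> complex" where
  "bc_comp1 Z = bc_fst Z - \<i> * bc_snd Z"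

definition bc_comp2 :: "bicomplex \<Rightarrow> complex" where
  "bc_comp2 Z = bc_fst Z + \<i> * bc_snd Z"

lemmas bc_basic_defs =
  bc_of_complex_def bc_of_real_def bc_j_def bc_k_def bc_e1_def bc_e2_def
  bc_comp1_def bc_comp2_def

lemma bicomplex_normal_form: "Z = bc_of_complex (bc_fst Z) + bc_of_complex (bc_snd Z) * bc_j"
  by (simp add: bicomplex_eq_iff bc_basic_defs)

lemma bc_units: "bc_of_complex \<i> * bc_of_complex \<i> = - 1" "bc_j * bc_j = - 1" "bc_k * bc_k = 1"
  by (simp_all add: bicomplex_eq_iff bc_basic_defs)

lemma bc_idempotents:
  "bc_e1 * bc_e1 = bc_e1" "bc_e2 * bc_e2 = bc_e2" "bc_e1 + bc_e2 = 1" "bc_e1 * bc_e2 = 0"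
  by (simp_all add: bicomplex_eq_iff bc_basic_defs)

lemma idempotent_decomposition:
  "Z = bc_e1 * bc_of_complex z1 + bc_e2 * bc_of_complex z2 \<longleftrightarrow>
     z1 = bc_comp1 Z \<and> z2 = bc_comp2 Z"
proof
  assume "Z = bc_e1 * bc_of_complex z1 + bc_e2 * bc_of_complex z2"
  then show "z1 = bc_comp1 Z \<and> z2 = bc_comp2 Z"
    by (auto simp: bicomplex_eq_iff bc_basic_defs complex_eq_iff field_simps)
next
  assume "z1 = bc_comp1 Z \<and> z2 = bc_comp2 Z"
  then show "Z = bc_e1 * bc_of_complex z1 + bc_e2 * bc_of_complex z2"
    by (auto simp: bicomplex_eq_iff bc_basic_defs complex_eq_iff field_simps)
qed

definition bc_modulus :: "bicomplex \<Rightarrow> bicomplex" where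
  "bc_modulus Z = bc_e1 * bc_of_real (cmod (bc_comp1 Z)) + bc_e2 * bc_of_real (cmod (bc_comp2 Z))"

section \<open>Hyperbolic numbers\<close>

definition hyperbolics :: "bicomplex set" where
  "hyperbolics = {bc_of_real b1 + bc_k * bc_of_real b2 | b1 b2. True}"

definition hyperbolics_nonneg :: "bicomplex set" where
  "hyperbolics_nonneg =
     {bc_e1 * bc_of_real a1 + bc_e2 * bc_of_real a2 | a1 a2. 0 \<le> a1 \<and> 0 \<le> a2}"

lemma hyperbolics_iff: "Z \<in> hyperbolics \<longleftrightarrow> bc_comp1 Z \<in> \<real> \<and> bc_comp2 Z \<in> \<real>"
proof
  assume "Z \<in> hyperbolics"
  then show "bc_comp1 Z \<in> \<real> \<and> bc_comp2 Z \<in> \<real>"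
    by (auto simp: hyperbolics_def bc_basic_defs complex_is_Real_iff)
next
  assume "bc_comp1 Z \<in> \<real> \<and> bc_comp2 Z \<in> \<real>"
  then have "Z = bc_of_real (Re (bc_fst Z)) + bc_k * bc_of_real (Im (bc_snd Z))"
    by (auto simp: bicomplex_eq_iff bc_basic_defs complex_is_Real_iff complex_eq_iff)
  then show "Z \<in> hyperbolics"
    unfolding hyperbolics_def by blast
qed

lemma hyperbolics_nonneg_subset: "hyperbolics_nonneg \<subseteq> hyperbolics"
  by (auto simp: hyperbolics_nonneg_def hyperbolics_iff bc_basic_defs complex_is_Real_iff)

definition hyp_le :: "bicomplex \<Rightarrow> bicomplex \<Rightarrow> bool" (infix "\<preceq>" 50) where
  "\<alpha> \<preceq> \<beta> \<longleftrightarrow> \<alpha> \<in> hyperbolics \<and> \<beta> \<in> hyperbolics \<and> \<beta> - \<alpha> \<in> hyperbolics_nonneg"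

definition hyp_bounded :: "bicomplex set \<Rightarrow> bool" where
  "hyp_bounded A \<longleftrightarrow>
     A \<subseteq> hyperbolics_nonneg \<and> (\<exists>M\<in>hyperbolics_nonneg. \<forall>\<alpha>\<in>A. \<alpha> \<preceq> M)"

definition hyp_tendsto :: "(nat \<Rightarrow> bicomplex) \<Rightarrow> bicomplex \<Rightarrow> bool" where
  "hyp_tendsto a l \<longleftrightarrow>
     (\<lambda>n. bc_comp1 (a n)) \<longlonglongrightarrow> bc_comp1 l \<and> (\<lambda>n. bc_comp2 (a n)) \<longlonglongrightarrow> bc_comp2 l"

section \<open>Hyperbolic semi-norms and F-BC modules\<close>

definition hyperbolic_seminorm ::
    "(bicomplex \<Rightarrow> 'x \<Rightarrow> 'x) \<Rightarrow> ('x::ab_group_add \<Rightarrow> bicomplex) \<Rightarrow> bool" where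
  "hyperbolic_seminorm smul p \<longleftrightarrow>
     (\<forall>x. p x \<in> hyperbolics_nonneg) \<and>
     (\<forall>\<mu> x. p (smul \<mu> x) = bc_modulus \<mu> * p x) \<and>
     (\<forall>x y. p (x + y) \<preceq> p x + p y)"

definition hyperbolic_norm ::
    "(bicomplex \<Rightarrow> 'x \<Rightarrow> 'x) \<Rightarrow> ('x::ab_group_add \<Rightarrow> bicomplex) \<Rightarrow> bool" where
  "hyperbolic_norm smul N \<longleftrightarrow>
     hyperbolic_seminorm smul N \<and> (\<forall>x. N x = 0 \<longrightarrow> x = 0)"

definition hnorm_tendsto ::
    "('x::ab_group_add \<Rightarrow> bicomplex) \<Rightarrow> (nat \<Rightarrow> 'x) \<Rightarrow> 'x \<Rightarrow> bool" where
  "hnorm_tendsto N xs x \<longleftrightarrow> hyp_tendsto (\<lambda>n. N (xs n - x)) 0"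

text \<open>As for convergence, the condition $\|x_m - x_n\|_{\mathbb{D}} \to 0$ is read componentwise
  with respect to $e_1, e_2$.\<close>

definition hnorm_Cauchy ::
    "('x::ab_group_add \<Rightarrow> bicomplex) \<Rightarrow> (nat \<Rightarrow> 'x) \<Rightarrow> bool" where
  "hnorm_Cauchy N xs \<longleftrightarrow>
     (\<forall>\<epsilon>>0. \<exists>n0. \<forall>m\<ge>n0. \<forall>n\<ge>n0.
        cmod (bc_comp1 (N (xs m - xs n))) < \<epsilon> \<and> cmod (bc_comp2 (N (xs m - xs n))) < \<epsilon>)"

definition F_BC_module ::
    "(bicomplex \<Rightarrow> 'x \<Rightarrow> 'x) \<Rightarrow> ('x::ab_group_add \<Rightarrow> bicomplex) \<Rightarrow> bool" where
  "F_BC_module smul N \<longleftrightarrow>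
     module smul \<and> hyperbolic_norm smul N \<and>
     (\<forall>xs. hnorm_Cauchy N xs \<longrightarrow> (\<exists>x. hnorm_tendsto N xs x))"

definition hnorm_continuous ::
    "('x::ab_group_add \<Rightarrow> bicomplex) \<Rightarrow> ('x \<Rightarrow> bicomplex) \<Rightarrow> bool" where
  "hnorm_continuous N p \<longleftrightarrow>
     (\<forall>xs x. hnorm_tendsto N xs x \<longrightarrow> hyp_tendsto (\<lambda>n. p (xs n)) (p x))"

end

(* A hyperbolic semi-norm p has two real components, and their sum is a real semi-norm q.
   For the sums of components, the classical Baire argument gives one constant C with
   q x \<le> C n x, where n belongs to the hyperbolic norm. Multiplication of x by e1 kills the second
   component of both p x and N x and keeps the first one, and similarly for e2; hence the inequality
   for the sums implies the inequality for each component, with \<delta> = C. *)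
theory Submission
  imports Defs
begin

section \<open>Uniform boundedness for real semi-norms\<close>

text \<open>The scalar multiplication is an explicit argument because the real structure on a
  bicomplex module comes from restricting \<open>smul\<close> to real scalars. Nonnegativity follows
  from the two clauses.\<close>

definition real_seminorm :: "(real \<Rightarrow> 'x::ab_group_add \<Rightarrow> 'x) \<Rightarrow> ('x \<Rightarrow> real) \<Rightarrow> bool" where
  "real_seminorm sc q \<longleftrightarrow>
     (\<forall>t x. q (sc t x) = \<bar>t\<bar> * q x) \<and> (\<forall>x y. q (x + y) \<le> q x + q y)"

context
  fixes sc :: "real \<Rightarrow> 'x::ab_group_add \<Rightarrow> 'x" and q :: "'x \<Rightarrow> real"
  assumes vs: "vector_space sc" and q: "real_seminorm sc q"
begin

interpretation vector_space sc
  by (rule vs)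

lemma real_seminorm_zero: "q 0 = 0"
  using q scale_zero_left unfolding real_seminorm_def by (metis abs_zero mult_zero_left)

lemma real_seminorm_minus: "q (- x) = q x"
proof -
  have "q (sc (-1) x) = \<bar>-1\<bar> * q x"
    using q unfolding real_seminorm_def by blast
  then show ?thesis
    by simp
qed

lemma real_seminorm_nonneg: "0 \<le> q x"
proof -
  have "q (x + - x) \<le> q x + q (- x)"
    using q unfolding real_seminorm_def by blast
  then show ?thesis
    by (simp add: real_seminorm_zero real_seminorm_minus)
qed

text \<open>A bound on a ball around \<open>a\<close> moves to the origin: if
  \<open>n y < r\<close>, then \<open>a + y\<close> and \<open>a - y\<close> both lie in the ball,
  as \<open>n\<close> is even, and \<open>2 * q y\<close> is the value of \<open>q\<close> at their
  difference.\<close>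

lemma real_seminorm_le_of_ball:
  assumes ball: "\<And>y. n (y - a) < r \<Longrightarrow> q y \<le> m" and n_minus: "\<And>x. n (- x) = n x"
    and "n y < r"
  shows "q y \<le> m"
proof -
  have "q (a + y) \<le> m" "q (a - y) \<le> m"
    using assms by (auto intro!: ball)
  moreover have "q ((a + y) + - (a - y)) \<le> q (a + y) + q (- (a - y))"
    using q unfolding real_seminorm_def by blast
  moreover have "q ((a + y) + - (a - y)) = 2 * q y"
  proof -
    have "(a + y) + - (a - y) = sc 2 y"
      using scale_left_distrib[of 1 1 y] by (simp add: algebra_simps)
    then show ?thesis
      using q unfolding real_seminorm_def by simp
  qed
  ultimately show ?thesis
    by (simp only: real_seminorm_minus)
qed

end

lemma real_uniform_boundedness:
  fixes sc :: "real \<Rightarrow> 'x::ab_group_add \<Rightarrow> 'x"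
  assumes vs: "vector_space sc"
    and n: "real_seminorm sc n" and n_eq_0: "\<And>x. n x = 0 \<Longrightarrow> x = 0"
    and complete: "\<And>xs. (\<And>\<epsilon>. \<epsilon> > 0 \<Longrightarrow> \<exists>n0. \<forall>i\<ge>n0. \<forall>j\<ge>n0. n (xs i - xs j) < \<epsilon>) \<Longrightarrow>
      \<exists>x. (\<lambda>i. n (xs i - x)) \<longlonglongrightarrow> 0"
    and Q: "\<And>q. q \<in> Q \<Longrightarrow> real_seminorm sc q"
    and cont: "\<And>q xs x. q \<in> Q \<Longrightarrow> (\<lambda>i. n (xs i - x)) \<longlonglongrightarrow> 0 \<Longrightarrow> (\<lambda>i. q (xs i)) \<longlonglongrightarrow> q x"
    and bounded: "\<And>x. \<exists>M. \<forall>q\<in>Q. q x \<le> M"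
  shows "\<exists>C\<ge>0. \<forall>q\<in>Q. \<forall>x. q x \<le> C * n x"
proof -
  interpret vector_space sc
    by (rule vs)
  note n_minus = real_seminorm_minus[OF vs n]
  note n_nonneg = real_seminorm_nonneg[OF vs n]
  \<comment> \<open>The type \<open>'x\<close> carries no topology, so Baire's theorem is used for
    the explicit metric induced by \<open>n\<close>.\<close>
  interpret M: Metric_space UNIV "\<lambda>x y. n (x - y)"
  proof
    show "n (x - y) = n (y - x)" for x y
      using n_minus[of "x - y"] by simp
    show "n (x - z) \<le> n (x - y) + n (y - z)" for x y z
      using n unfolding real_seminorm_def by (metis diff_add_cancel add_diff_eq)
    show "n (x - y) = 0 \<longleftrightarrow> x = y" for x y
      using n_eq_0[of "x - y"] real_seminorm_zero[OF vs n] by auto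
  qed (rule n_nonneg)
  have lim: "limitin M.mtopology xs x sequentially \<longleftrightarrow> (\<lambda>i. n (xs i - x)) \<longlonglongrightarrow> 0" for xs x
    by (simp add: M.limitin_metric_dist_null)
  have mcomplete: M.mcomplete
    unfolding M.mcomplete_def lim
  proof (intro allI impI complete)
    fix xs :: "nat \<Rightarrow> 'x" and \<epsilon> :: real
    assume "M.MCauchy xs" "\<epsilon> > 0"
    then show "\<exists>n0. \<forall>i\<ge>n0. \<forall>j\<ge>n0. n (xs i - xs j) < \<epsilon>"
      unfolding M.MCauchy_def by meson
  qed
  \<comment> \<open>Each \<open>F m\<close> is closed by sequential continuity of every
    \<open>q\<close>, and pointwise boundedness makes these sets cover the space.\<close>
  define F where "F m = {x. \<forall>q\<in>Q. q x \<le> real m}" for m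
  have closed: "closedin M.mtopology (F m)" for m
    unfolding M.metric_closedin_iff_sequentially_closed lim
  proof (intro conjI allI impI)
    fix xs l
    assume *: "range xs \<subseteq> F m \<and> (\<lambda>i. n (xs i - l)) \<longlonglongrightarrow> 0"
    have "q l \<le> real m" if "q \<in> Q" for q
    proof (rule LIMSEQ_le_const2)
      show "(\<lambda>i. q (xs i)) \<longlonglongrightarrow> q l"
        using cont that * by blast
      show "\<exists>k. \<forall>i\<ge>k. q (xs i) \<le> real m"
        using * that by (auto simp: F_def)
    qed
    then show "l \<in> F m"
      by (simp add: F_def)
  qed simp
  have "\<exists>m. x \<in> F m" for x
  proof -
    obtain M where "\<forall>q\<in>Q. q x \<le> M"
      using bounded by blast
    moreover obtain m :: nat where "M \<le> real m"
      using real_arch_simple by blast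
    ultimately show ?thesis
      by (intro exI[of _ m]) (force simp: F_def)
  qed
  then have "\<Union>(range F) = UNIV"
    by blast
  then have "M.mtopology interior_of \<Union>(range F) \<noteq> {}"
    using interior_of_topspace[of M.mtopology] by simp
  \<comment> \<open>Baire in contrapositive form: a countable union of closed sets with empty
    interior has empty interior, but this union is the whole space.\<close>
  then obtain m where "M.mtopology interior_of F m \<noteq> {}"
    using M.metric_Baire_category_alt[OF mcomplete, of "range F"] closed by auto
  then obtain a r where "r > 0" and r: "M.mball a r \<subseteq> F m"
    unfolding M.metric_interior_of by blast
  have ball: "q y \<le> real m" if "q \<in> Q" "n (y - a) < r" for q y
    using r that M.commute[of y a] by (auto simp: F_def)
  have "q x \<le> (2 * real m / r) * n x" if "q \<in> Q" for q x
  proof (cases "x = 0")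
    case True
    then show ?thesis
      using real_seminorm_zero[OF vs n] real_seminorm_zero[OF vs Q[OF that]] by simp
  next
    case False
    then have pos: "n x > 0"
      using n_eq_0 n_nonneg[of x] by (auto simp: less_le)
    \<comment> \<open>This scaling gives \<open>n (sc t x) = r / 2\<close>, strictly inside the open
      ball; dividing \<open>t * q x \<le> real m\<close> by \<open>t\<close> produces the constant
      \<open>2 * real m / r\<close>.\<close>
    define t where "t = r / (2 * n x)"
    have "t > 0"
      using pos \<open>r > 0\<close> by (simp add: t_def)
    have small: "n (sc t x) < r"
      using n \<open>t > 0\<close> \<open>r > 0\<close> pos by (simp add: real_seminorm_def t_def)
    have "q (sc t x) \<le> real m"
      by (rule real_seminorm_le_of_ball[where n = n, OF vs Q[OF that] ball[OF that] n_minus small])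
    then have "t * q x \<le> real m"
      using Q[OF that] \<open>t > 0\<close> by (simp add: real_seminorm_def)
    then show ?thesis
      using pos \<open>r > 0\<close> by (simp add: t_def field_simps)
  qed
  then show ?thesis
    using \<open>r > 0\<close> by (intro exI[of _ "2 * real m / r"]) simp
qed

section \<open>Components of hyperbolic semi-norms\<close>

lemma bc_comp_simps [simp]:
  "bc_comp1 (Z + W) = bc_comp1 Z + bc_comp1 W" "bc_comp2 (Z + W) = bc_comp2 Z + bc_comp2 W"
  "bc_comp1 (Z - W) = bc_comp1 Z - bc_comp1 W" "bc_comp2 (Z - W) = bc_comp2 Z - bc_comp2 W"
  "bc_comp1 (Z * W) = bc_comp1 Z * bc_comp1 W" "bc_comp2 (Z * W) = bc_comp2 Z * bc_comp2 W"
  "bc_comp1 0 = 0" "bc_comp2 0 = 0"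
  "bc_comp1 bc_e1 = 1" "bc_comp2 bc_e1 = 0" "bc_comp1 bc_e2 = 0" "bc_comp2 bc_e2 = 1"
  "bc_comp1 (bc_of_real r) = of_real r" "bc_comp2 (bc_of_real r) = of_real r"
  by (simp_all add: bc_basic_defs complex_eq_iff algebra_simps)

lemma bc_comp_eqI: "bc_comp1 Z = bc_comp1 W \<Longrightarrow> bc_comp2 Z = bc_comp2 W \<Longrightarrow> Z = W"
  using idempotent_decomposition by metis

lemma bc_comp_modulus [simp]:
  "bc_comp1 (bc_modulus Z) = of_real (cmod (bc_comp1 Z))"
  "bc_comp2 (bc_modulus Z) = of_real (cmod (bc_comp2 Z))"
  by (simp_all add: bc_modulus_def)

lemma hyperbolics_nonneg_iff:
  "Z \<in> hyperbolics_nonneg \<longleftrightarrow> (\<exists>a\<ge>0. \<exists>b\<ge>0. bc_comp1 Z = of_real a \<and> bc_comp2 Z = of_real b)"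
proof
  assume "Z \<in> hyperbolics_nonneg"
  then show "\<exists>a\<ge>0. \<exists>b\<ge>0. bc_comp1 Z = of_real a \<and> bc_comp2 Z = of_real b"
    by (auto simp: hyperbolics_nonneg_def)
next
  assume "\<exists>a\<ge>0. \<exists>b\<ge>0. bc_comp1 Z = of_real a \<and> bc_comp2 Z = of_real b"
  then obtain a b where ab: "a \<ge> 0" "b \<ge> 0"
      "bc_comp1 Z = complex_of_real a" "bc_comp2 Z = complex_of_real b"
    by blast
  then have "Z = bc_e1 * bc_of_real a + bc_e2 * bc_of_real b"
    by (intro bc_comp_eqI) simp_all
  with ab show "Z \<in> hyperbolics_nonneg"
    unfolding hyperbolics_nonneg_def by blast
qed

text \<open>The coordinates of a hyperbolic number are real but have type \<open>complex\<close>; on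
  \<open>hyperbolics_nonneg\<close> taking \<open>Re\<close> loses nothing.\<close>

definition hre1 :: "bicomplex \<Rightarrow> real" where
  "hre1 Z = Re (bc_comp1 Z)"

definition hre2 :: "bicomplex \<Rightarrow> real" where
  "hre2 Z = Re (bc_comp2 Z)"

lemmas hre_defs = hre1_def hre2_def

lemma hyperbolics_nonneg_hre:
  assumes "Z \<in> hyperbolics_nonneg"
  shows "0 \<le> hre1 Z" "0 \<le> hre2 Z" "bc_comp1 Z = of_real (hre1 Z)" "bc_comp2 Z = of_real (hre2 Z)"
  using assms by (auto simp: hyperbolics_nonneg_iff hre_defs)

lemma hyp_le_hre: "\<alpha> \<preceq> \<beta> \<Longrightarrow> hre1 \<alpha> \<le> hre1 \<beta> \<and> hre2 \<alpha> \<le> hre2 \<beta>"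
  using hyperbolics_nonneg_hre(1,2)[of "\<beta> - \<alpha>"] by (simp add: hyp_le_def hre_defs)

lemma hyp_leI:
  assumes "\<alpha> \<in> hyperbolics_nonneg" "\<beta> \<in> hyperbolics_nonneg"
    and "hre1 \<alpha> \<le> hre1 \<beta>" "hre2 \<alpha> \<le> hre2 \<beta>"
  shows "\<alpha> \<preceq> \<beta>"
proof -
  have "\<beta> - \<alpha> \<in> hyperbolics_nonneg"
    unfolding hyperbolics_nonneg_iff using assms
    by (intro exI[of _ "hre1 \<beta> - hre1 \<alpha>"] exI[of _ "hre2 \<beta> - hre2 \<alpha>"] conjI)
      (simp_all add: hyperbolics_nonneg_hre)
  then show ?thesis
    using assms hyperbolics_nonneg_subset by (auto simp: hyp_le_def)
qed

text \<open>On \<open>hyperbolics_nonneg\<close> this is the l1 norm of the coordinate pair, so it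
  dominates both coordinates.\<close>

definition hsum :: "bicomplex \<Rightarrow> real" where
  "hsum Z = hre1 Z + hre2 Z"

lemma hyp_tendsto_hsum: "hyp_tendsto a l \<Longrightarrow> (\<lambda>i. hsum (a i)) \<longlonglongrightarrow> hsum l"
  by (auto simp: hyp_tendsto_def hsum_def hre_defs intro!: tendsto_intros)

text \<open>For the converse direction, each coordinate is squeezed between 0 and the sum.\<close>

lemma hyp_tendsto_0_iff:
  assumes "\<And>i. a i \<in> hyperbolics_nonneg"
  shows "hyp_tendsto a 0 \<longleftrightarrow> (\<lambda>i. hsum (a i)) \<longlonglongrightarrow> 0"
proof
  assume "hyp_tendsto a 0"
  then show "(\<lambda>i. hsum (a i)) \<longlonglongrightarrow> 0"
    using hyp_tendsto_hsum by (force simp: hsum_def hre_defs)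
next
  note a = hyperbolics_nonneg_hre[OF assms]
  assume *: "(\<lambda>i. hsum (a i)) \<longlonglongrightarrow> 0"
  have "(\<lambda>i. hre1 (a i)) \<longlonglongrightarrow> 0" "(\<lambda>i. hre2 (a i)) \<longlonglongrightarrow> 0"
    by (rule tendsto_sandwich[OF _ _ tendsto_const *]; simp add: a hsum_def)+
  then show "hyp_tendsto a 0"
    by (auto simp: hyp_tendsto_def a intro!: tendsto_eq_intros)
qed

section \<open>Behaviour of the components under scalars\<close>

lemma hyperbolic_seminormD:
  assumes "hyperbolic_seminorm smul p"
  shows "p x \<in> hyperbolics_nonneg" "p (smul \<mu> x) = bc_modulus \<mu> * p x" "p (x + y) \<preceq> p x + p y"
  using assms by (auto simp: hyperbolic_seminorm_def)

text \<open>The hyperbolic modulus acts coordinatewise, so the two components scale independently;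
  an idempotent scalar can therefore isolate one of them.\<close>

lemma hre_seminorm_smul:
  assumes "hyperbolic_seminorm smul p"
  shows "hre1 (p (smul \<mu> x)) = cmod (bc_comp1 \<mu>) * hre1 (p x)"
    and "hre2 (p (smul \<mu> x)) = cmod (bc_comp2 \<mu>) * hre2 (p x)"
  using hyperbolic_seminormD(2)[OF assms] by (simp_all add: hre_defs)

text \<open>A real scalar \<open>t\<close> has both coordinates equal to \<open>t\<close>, so both
  components scale by the same factor \<bar>t\<bar> and so does their sum.\<close>

lemma real_seminorm_hsum:
  assumes "hyperbolic_seminorm smul p"
  shows "real_seminorm (\<lambda>t. smul (bc_of_real t)) (\<lambda>x. hsum (p x))"
proof -
  have "hsum (p (x + y)) \<le> hsum (p x) + hsum (p y)" for x y
    using hyp_le_hre[OF hyperbolic_seminormD(3)[OF assms, of x y]]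
    by (simp add: hsum_def hre_defs)
  then show ?thesis
    by (simp add: real_seminorm_def hsum_def hre_seminorm_smul[OF assms] distrib_left)
qed

text \<open>Restriction of scalars along the ring homomorphism \<open>bc_of_real\<close>.\<close>

lemma vector_space_bc_of_real:
  assumes "module smul"
  shows "vector_space (\<lambda>t. smul (bc_of_real t))"
proof -
  interpret module smul
    by (rule assms)
  have hom: "bc_of_real (s + t) = bc_of_real s + bc_of_real t"
    "bc_of_real (s * t) = bc_of_real s * bc_of_real t" "bc_of_real 1 = 1" for s t
    by (simp_all add: bc_basic_defs bicomplex_eq_iff)
  show ?thesis
    by unfold_locales (simp_all add: hom scale_right_distrib scale_left_distrib)
qed

theorem theorem4p3:
  fixes smul :: "bicomplex \<Rightarrow> 'x::ab_group_add \<Rightarrow> 'x"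
    and N :: "'x \<Rightarrow> bicomplex"
    and P0 :: "('x \<Rightarrow> bicomplex) set"
  assumes "F_BC_module smul N"
    and "\<And>p. p \<in> P0 \<Longrightarrow> hyperbolic_seminorm smul p \<and> hnorm_continuous N p"
    and "\<And>x. hyp_bounded {p x | p. p \<in> P0}"
  shows "\<exists>\<delta>\<in>hyperbolics_nonneg. \<forall>p\<in>P0. \<forall>x. p x \<preceq> \<delta> * N x"
proof -
  have mod: "module smul" and N: "hyperbolic_seminorm smul N" and N_eq_0: "\<And>x. N x = 0 \<Longrightarrow> x = 0"
    and N_complete: "\<And>xs. hnorm_Cauchy N xs \<Longrightarrow> \<exists>x. hnorm_tendsto N xs x"
    using assms(1) by (auto simp: F_BC_module_def hyperbolic_norm_def)
  note N_hre = hyperbolics_nonneg_hre[OF hyperbolic_seminormD(1)[OF N]]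
  have lim: "hnorm_tendsto N xs x \<longleftrightarrow> (\<lambda>i. hsum (N (xs i - x))) \<longlonglongrightarrow> 0" for xs x
    unfolding hnorm_tendsto_def by (rule hyp_tendsto_0_iff) (rule hyperbolic_seminormD(1)[OF N])
  have "\<exists>C\<ge>0. \<forall>q\<in>(\<lambda>p x. hsum (p x)) ` P0. \<forall>x. q x \<le> C * hsum (N x)"
  proof (rule real_uniform_boundedness[OF vector_space_bc_of_real[OF mod] real_seminorm_hsum[OF N]])
    fix x
    assume "hsum (N x) = 0"
    then have "hre1 (N x) = 0" "hre2 (N x) = 0"
      using N_hre(1,2)[of x] by (auto simp: hsum_def)
    then show "x = 0"
      by (intro N_eq_0 bc_comp_eqI) (simp_all add: N_hre)
  next
    fix xs :: "nat \<Rightarrow> 'x"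
    assume *: "\<And>\<epsilon>. \<epsilon> > 0 \<Longrightarrow> \<exists>n0. \<forall>i\<ge>n0. \<forall>j\<ge>n0. hsum (N (xs i - xs j)) < \<epsilon>"
    \<comment> \<open>Smallness of the sum forces smallness of both components, so a Cauchy sequence
      for the sum is Cauchy in the hyperbolic sense.\<close>
    have le: "cmod (bc_comp1 (N x)) \<le> hsum (N x)" "cmod (bc_comp2 (N x)) \<le> hsum (N x)" for x
      using N_hre[of x] by (simp_all add: hsum_def)
    have "hnorm_Cauchy N xs"
      unfolding hnorm_Cauchy_def using * by (meson le le_less_trans)
    then show "\<exists>x. (\<lambda>i. hsum (N (xs i - x))) \<longlonglongrightarrow> 0"
      using N_complete lim by blast
  next
    fix q
    assume "q \<in> (\<lambda>p x. hsum (p x)) ` P0"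
    then obtain p where p: "p \<in> P0" "q = (\<lambda>x. hsum (p x))"
      by blast
    then show "real_seminorm (\<lambda>t. smul (bc_of_real t)) q"
      using assms(2) by (simp add: real_seminorm_hsum)
    show "(\<lambda>i. q (xs i)) \<longlonglongrightarrow> q x" if "(\<lambda>i. hsum (N (xs i - x))) \<longlonglongrightarrow> 0" for xs x
      using assms(2)[OF p(1)] that p(2) hyp_tendsto_hsum
      unfolding hnorm_continuous_def lim by blast
  next
    fix x
    \<comment> \<open>The sum of components is monotone for \<open>\<preceq>\<close>, so a
      hyperbolic bound at \<open>x\<close> yields the real bound \<open>hsum M\<close>.\<close>
    obtain M where "\<forall>\<alpha>\<in>{p x | p. p \<in> P0}. \<alpha> \<preceq> M"
      using assms(3)[of x] unfolding hyp_bounded_def by blast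
    then have "\<forall>p\<in>P0. hsum (p x) \<le> hsum M"
      using hyp_le_hre by (fastforce simp: hsum_def)
    then show "\<exists>M. \<forall>q\<in>(\<lambda>p x. hsum (p x)) ` P0. q x \<le> M"
      by blast
  qed
  then obtain C where "C \<ge> 0" and C: "\<And>p x. p \<in> P0 \<Longrightarrow> hsum (p x) \<le> C * hsum (N x)"
    by auto
  show ?thesis
  proof (intro bexI ballI allI)
    \<comment> \<open>The witness has both coordinates equal to \<open>C\<close>, since one constant
      serves both components.\<close>
    show nonneg: "bc_of_real C \<in> hyperbolics_nonneg"
      using \<open>C \<ge> 0\<close> by (auto simp: hyperbolics_nonneg_iff)
    fix p x
    assume "p \<in> P0"
    then have p: "hyperbolic_seminorm smul p"
      using assms(2) by blast
    show "p x \<preceq> bc_of_real C * N x"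
    proof (rule hyp_leI)
      show "p x \<in> hyperbolics_nonneg"
        using p by (rule hyperbolic_seminormD)
      show "bc_of_real C * N x \<in> hyperbolics_nonneg"
        unfolding hyperbolics_nonneg_iff using \<open>C \<ge> 0\<close> N_hre
        by (intro exI[of _ "C * hre1 (N x)"] exI[of _ "C * hre2 (N x)"] conjI)
          simp_all
      \<comment> \<open>At \<open>smul bc_e1 x\<close> the second components of \<open>p\<close> and
        \<open>N\<close> vanish and the first keep their values at \<open>x\<close>, so the bound on
        sums becomes one on first components. The next case uses \<open>bc_e2\<close> in the same
        way.\<close>
      show "hre1 (p x) \<le> hre1 (bc_of_real C * N x)"
        using C[OF \<open>p \<in> P0\<close>, of "smul bc_e1 x"]
        by (simp add: hsum_def hre_seminorm_smul[OF p] hre_seminorm_smul[OF N])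
          (simp add: hre_defs)
      show "hre2 (p x) \<le> hre2 (bc_of_real C * N x)"
        using C[OF \<open>p \<in> P0\<close>, of "smul bc_e2 x"]
        by (simp add: hsum_def hre_seminorm_smul[OF p] hre_seminorm_smul[OF N])
          (simp add: hre_defs)
    qed
  qed
qed

end
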